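(* Let $f:\mathbb{R}^{n+m}\to\mathbb{R}$ be a $C^2$ function such that $\nabla f$ is globally Lipschitz with constant $L>0$ and $\nabla^2 f(z^\ast)$ is invertible at every saddle point $z^\ast$ of $f$. Let $\tau>0$ and, for $s>0$, let $w_s=(I+s\Lambda_\tau F)^{-1}$ (the Two-Timescale Proximal Point method with $\alpha_y=s$, $\alpha_x=s/\tau$) and $W_s(z)=\big(-I+\tfrac{s}{2}\Lambda_\tau\nabla F(z)\big)\Lambda_\tau F(z)$ (its $O(s)$-resolution vector field). Assume that $w_s$ and $W_s$ are $C^1$ and satisfy the one-step consistency condition: there is an integer $r\ge2$ such that for every $z_0\in\mathbb{R}^{n+m}$, $|Z(s;z_0)-w_s(z_0)|\le O(s^r)$, where $Z(s;z_0)$ is the solution of $\dot Z=W_s(Z)$ at time $s$ with $Z(0)=z_0$. Then there exists $s^\ast>0$ such that for all $s\in(0,s^\ast)$, the set of saddle points of $f$ is a subset of the set of exponentially stable equilibria of $z_{k+1}=(I+s\Lambda_\tau F)^{-1}(z_k)$.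
   Context: Write $z=(x,y)\in\mathbb{R}^n\times\mathbb{R}^m$. A (local) saddle point of $f$ is a point $(x^\ast,y^\ast)$ having a neighbourhood $U$ such that $f(x^\ast,y)\le f(x^\ast,y^\ast)\le f(x,y^\ast)$ for all $(x,y)\in U$. Notation: $F(z)=\begin{bmatrix}\nabla_x f(z)\\-\nabla_y f(z)\end{bmatrix}$, $\nabla F$ is the Jacobian matrix of $F$, $\Lambda_\tau=\begin{bmatrix}\frac1\tau I&0\\0&I\end{bmatrix}$ (blocks of sizes $n$ and $m$). $(I+s\Lambda_\tau F)^{-1}$ denotes the inverse of the map $z\mapsto z+s\Lambda_\tau F(z)$, so the iteration is $z_{k+1}=z_k-s\Lambda_\tau F(z_{k+1})$ (only $s$ small enough for this inverse to exist is relevant). "$\le O(s^r)$" means: for the given $z_0$ there are $C\ge0$, $s_0>0$ with the left-hand side at most $Cs^r$ for all $s\in(0,s_0]$. An equilibrium (fixed point) $z^e$ of $z_{k+1}=w_s(z_k)$ is exponentially stable (meant locally) if it is stable (for every $\varepsilon>0$ there is $\delta>0$ such that $|z_0-z^e|<\delta$ implies $|z_k-z^e|<\varepsilon$ for all $k\ge0$) and there exist $\delta>0$, $M>0$, $\gamma\in(0,1)$ such that $|z_0-z^e|<\delta$ implies $|z_k-z^e|\le M|z_0-z^e|\gamma^k$ for all $k\ge0$. *)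

theory Defs
  imports "HOL-Analysis.Analysis"
begin

text \<open>
  The space \<open>R^(n+m) = R^n \<times> R^m\<close> is rendered as \<^typ>\<open>real ^ ('n + 'm)\<close>: indices \<open>Inl i\<close> address the
  \<open>x\<close>-block and indices \<open>Inr j\<close> the \<open>y\<close>-block, so that Jacobians and Hessians are square matrices.
\<close>

definition join :: "real ^ 'n \<Rightarrow> real ^ 'm \<Rightarrow> real ^ ('n::finite + 'm::finite)" where
  "join x y = (\<chi> k. case k of Inl i \<Rightarrow> x $ i | Inr j \<Rightarrow> y $ j)"

definition saddle_point :: "(real ^ ('n::finite + 'm::finite) \<Rightarrow> real) \<Rightarrow> real ^ ('n + 'm) \<Rightarrow> bool" where
  "saddle_point f z \<longleftrightarrow>
     (\<exists>x0 y0 U. z = join x0 y0 \<and> open U \<and> z \<in> U \<and>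
        (\<forall>x y. join x y \<in> U \<longrightarrow> f (join x0 y) \<le> f (join x0 y0) \<and> f (join x0 y0) \<le> f (join x y0)))"

definition grad :: "(real ^ 'k \<Rightarrow> real) \<Rightarrow> real ^ 'k \<Rightarrow> real ^ 'k::finite" where
  "grad f z = (\<chi> k. frechet_derivative f (at z) (axis k 1))"

lemma GDERIV_grad:
  assumes "f differentiable (at z)"
  shows "GDERIV f z :> grad f z"
proof -
  let ?D = "frechet_derivative f (at z)"
  have D: "(f has_derivative ?D) (at z)"
    using assms by (simp add: frechet_derivative_works)
  then have lin: "linear ?D" by (rule has_derivative_linear)
  have "?D h = inner h (grad f z)" for h
  proof -
    have "?D h = ?D (\<Sum>k\<in>UNIV. (h $ k) *\<^sub>R axis k 1)"
      using basis_expansion[of h] by (simp add: scalar_mult_eq_scaleR)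
    also have "\<dots> = (\<Sum>k\<in>UNIV. h $ k * ?D (axis k 1))"
      by (simp add: linear_sum[OF lin] linear_cmul[OF lin])
    finally show ?thesis by (simp add: inner_vec_def grad_def)
  qed
  then have "?D = (\<lambda>h. inner h (grad f z))" by blast
  with D show ?thesis by (simp add: gderiv_def)
qed

definition hessian :: "(real ^ 'k \<Rightarrow> real) \<Rightarrow> real ^ 'k \<Rightarrow> real ^ 'k ^ 'k::finite" where
  "hessian f z = jacobian (grad f) (at z)"

definition C1_map :: "(real ^ 'k::finite \<Rightarrow> real ^ 'l::finite) \<Rightarrow> bool" where
  "C1_map g \<longleftrightarrow> (\<forall>z. g differentiable (at z)) \<and> continuous_on UNIV (\<lambda>z. jacobian g (at z))"

definition C2_fun :: "(real ^ 'k::finite \<Rightarrow> real) \<Rightarrow> bool" where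
  "C2_fun f \<longleftrightarrow> (\<forall>z. f differentiable (at z)) \<and> C1_map (grad f)"

definition saddle_field ::
    "(real ^ ('n::finite + 'm::finite) \<Rightarrow> real) \<Rightarrow> real ^ ('n + 'm) \<Rightarrow> real ^ ('n + 'm)" where
  "saddle_field f z = (\<chi> k. case k of Inl i \<Rightarrow> grad f z $ k | Inr j \<Rightarrow> - grad f z $ k)"

definition timescale :: "real \<Rightarrow> real ^ ('n + 'm) ^ ('n::finite + 'm::finite)" where
  "timescale \<tau> = (\<chi> k l. if k = l then (case k of Inl i \<Rightarrow> 1 / \<tau> | Inr j \<Rightarrow> 1) else 0)"

definition resolvent_map ::
    "(real ^ ('n::finite + 'm::finite) \<Rightarrow> real) \<Rightarrow> real \<Rightarrow> real \<Rightarrow> real ^ ('n + 'm) \<Rightarrow> real ^ ('n + 'm)" where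
  "resolvent_map f \<tau> s z = z + s *\<^sub>R (timescale \<tau> *v saddle_field f z)"

text \<open>Only meaningful for step sizes \<open>s\<close> at which \<open>resolvent_map f \<tau> s\<close> is a bijection.\<close>

definition ttpp_step ::
    "(real ^ ('n::finite + 'm::finite) \<Rightarrow> real) \<Rightarrow> real \<Rightarrow> real \<Rightarrow> real ^ ('n + 'm) \<Rightarrow> real ^ ('n + 'm)" where
  "ttpp_step f \<tau> s = inv (resolvent_map f \<tau> s)"

definition ttpp_field ::
    "(real ^ ('n::finite + 'm::finite) \<Rightarrow> real) \<Rightarrow> real \<Rightarrow> real \<Rightarrow> real ^ ('n + 'm) \<Rightarrow> real ^ ('n + 'm)" where
  "ttpp_field f \<tau> s z =
     (- mat 1 + (s / 2) *\<^sub>R (timescale \<tau> ** jacobian (saddle_field f) (at z)))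
       *v (timescale \<tau> *v saddle_field f z)"

definition solves_ivp ::
    "('a::real_normed_vector \<Rightarrow> 'a) \<Rightarrow> 'a \<Rightarrow> real \<Rightarrow> (real \<Rightarrow> 'a) \<Rightarrow> bool" where
  "solves_ivp W z0 T Z \<longleftrightarrow>
     Z 0 = z0 \<and> (\<forall>t\<in>{0..T}. (Z has_vector_derivative W (Z t)) (at t within {0..T}))"

text \<open>
  The vector field depends on the step size. For the \<open>C\<^sup>1\<close> fields to which this is applied, a
  solution is unique, so \<open>Z s\<close> below is the value at time \<open>s\<close> of the solution starting at \<open>z0\<close>.
\<close>

definition one_step_consistent ::
    "(real \<Rightarrow> 'a \<Rightarrow> 'a) \<Rightarrow> (real \<Rightarrow> 'a \<Rightarrow> 'a::real_normed_vector) \<Rightarrow> nat \<Rightarrow> bool" where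
  "one_step_consistent w W r \<longleftrightarrow>
     (\<forall>z0. \<exists>C\<ge>0. \<exists>s0>0. \<forall>s\<in>{0<..s0}.
        \<exists>Z. solves_ivp (W s) z0 s Z \<and> norm (Z s - w s z0) \<le> C * s ^ r)"

definition stable_equilibrium :: "('a::metric_space \<Rightarrow> 'a) \<Rightarrow> 'a \<Rightarrow> bool" where
  "stable_equilibrium w ze \<longleftrightarrow> w ze = ze \<and>
     (\<forall>\<epsilon>>0. \<exists>\<delta>>0. \<forall>z0. dist z0 ze < \<delta> \<longrightarrow> (\<forall>k. dist ((w ^^ k) z0) ze < \<epsilon>))"

definition exp_stable_equilibrium :: "('a::metric_space \<Rightarrow> 'a) \<Rightarrow> 'a \<Rightarrow> bool" where
  "exp_stable_equilibrium w ze \<longleftrightarrow> stable_equilibrium w ze \<and>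
     (\<exists>\<delta>>0. \<exists>M>0. \<exists>\<gamma>. 0 < \<gamma> \<and> \<gamma> < 1 \<and>
        (\<forall>z0. dist z0 ze < \<delta> \<longrightarrow> (\<forall>k. dist ((w ^^ k) z0) ze \<le> M * dist z0 ze * \<gamma> ^ k)))"

end

theory Submission
  imports Defs
begin

text \<open>
  Measure vectors by \<open>|D u|\<close>, where \<open>D\<close> is the positive diagonal matrix with \<open>D\<^sup>2\<close> inverse to the
  timescale matrix. At a saddle point the second-order conditions and the symmetry of the Hessian
  make the Jacobian \<open>J\<close> of the field monotone, \<open>\<langle>u, J u\<rangle> \<ge> 0\<close>, so with \<open>M\<close> the rescaled Jacobian
  \<open>|D (u + s M u)|\<^sup>2 \<ge> |D u|\<^sup>2 + s\<^sup>2 |D M u|\<^sup>2\<close>. As \<open>M\<close> is invertible, \<open>I + s M\<close> is a strict expansion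
  for every \<open>s > 0\<close>, and hence the resolvent contracts near the saddle point. The step size only has
  to be small for the resolvent to exist globally, so one bound serves all saddle points.
\<close>

subsection \<open>Symmetry and sign of second derivatives\<close>

lemma GDERIV_line:
  fixes f :: "'a::real_inner \<Rightarrow> real"
  assumes "GDERIV f (z + t *\<^sub>R a) :> d"
  shows "((\<lambda>t. f (z + t *\<^sub>R a)) has_real_derivative a \<bullet> d) (at t)"
proof -
  have "((\<lambda>t. z + t *\<^sub>R a) has_derivative (\<lambda>h. h *\<^sub>R a)) (at t)"
    by (auto intro!: derivative_eq_intros)
  from has_derivative_compose[OF this] assms
  have "((\<lambda>t. f (z + t *\<^sub>R a)) has_derivative (\<lambda>h. (h *\<^sub>R a) \<bullet> d)) (at t)"
    unfolding gderiv_def by blast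
  then show ?thesis
    by (simp add: has_field_derivative_def mult.commute[of _ "a \<bullet> d"] mult_commute_abs)
qed

text \<open>The second difference is the increment of \<open>\<phi>\<close> over
  \<open>[0, t]\<close>. The mean value theorem turns it into a difference of \<open>g\<close> at
  two points near \<open>z\<close>, where the derivative of \<open>g\<close> at \<open>z\<close>
  controls both values.\<close>

lemma second_difference_bound:
  fixes f :: "'a::real_inner \<Rightarrow> real"
  assumes f: "\<And>z. GDERIV f z :> g z" and g: "(g has_derivative H) (at z)" and "\<epsilon> > 0"
  shows "\<exists>t0>0. \<forall>t. 0 < t \<and> t < t0 \<longrightarrow>
    \<bar>f (z + t *\<^sub>R a + t *\<^sub>R b) - f (z + t *\<^sub>R a) - f (z + t *\<^sub>R b) + f z - t\<^sup>2 * (a \<bullet> H b)\<bar> \<le> \<epsilon> * t\<^sup>2"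
proof -
  \<comment> \<open>\<open>m\<close> bounds \<open>norm a\<close>, and both arguments of
    \<open>g\<close> lie within \<open>t * m\<close> of \<open>z\<close>. Two remainders of size
    \<epsilon> / (2 m^2) * (t m), multiplied by \<open>t * norm a\<close>, then add up to at most
    \<epsilon> t^2. The 1 keeps \<open>m\<close> positive when \<open>a\<close> and \<open>b\<close>
    vanish.\<close>
  define m where "m = norm a + norm b + 1"
  have m: "m > 0" "norm a \<le> m" "norm a + norm b \<le> m" unfolding m_def by (auto simp: add_nonneg_pos)
  have "\<epsilon> / (2 * m\<^sup>2) > 0" using m \<open>\<epsilon> > 0\<close> by simp
  then obtain d where d: "d > 0"
    "\<And>y. norm (y - z) < d \<Longrightarrow> norm (g y - g z - H (y - z)) \<le> \<epsilon> / (2 * m\<^sup>2) * norm (y - z)"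
    using g unfolding has_derivative_at_alt by blast
  have lin: "linear H" using g has_derivative_linear by blast
  show ?thesis
  proof (intro exI[of _ "d / m"] conjI allI impI)
    fix t assume t: "0 < t \<and> t < d / m"
    define \<phi> where "\<phi> \<sigma> = f (z + t *\<^sub>R b + \<sigma> *\<^sub>R a) - f (z + \<sigma> *\<^sub>R a)" for \<sigma>
    have "(\<phi> has_real_derivative a \<bullet> (g (z + t *\<^sub>R b + \<sigma> *\<^sub>R a) - g (z + \<sigma> *\<^sub>R a))) (at \<sigma>)" for \<sigma>
      unfolding \<phi>_def inner_diff_right by (intro DERIV_diff GDERIV_line f)
    from MVT2[of 0 t \<phi>, OF _ this] t obtain \<xi> where \<xi>: "0 < \<xi>" "\<xi> < t"
      and eq: "\<phi> t - \<phi> 0 = t * (a \<bullet> (g (z + t *\<^sub>R b + \<xi> *\<^sub>R a) - g (z + \<xi> *\<^sub>R a)))" by auto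
    define e where "e y = g (z + y) - g z - H y" for y
    have e: "norm (e y) \<le> \<epsilon> / (2 * m) * t" if "norm y \<le> t * m" for y
    proof -
      have "t * m < d" using t m by (simp add: field_simps)
      then have "norm (e y) \<le> \<epsilon> / (2 * m\<^sup>2) * norm y" using d(2)[of "z + y"] that by (simp add: e_def)
      also have "\<dots> \<le> \<epsilon> / (2 * m\<^sup>2) * (t * m)" using that \<open>\<epsilon> > 0\<close> by (intro mult_left_mono) auto
      finally show ?thesis using m by (simp add: power2_eq_square)
    qed
    have n1: "norm (\<xi> *\<^sub>R a) \<le> t * norm a" using \<xi> by (simp add: mult_right_mono)
    have "norm (t *\<^sub>R b + \<xi> *\<^sub>R a) \<le> t * norm b + t * norm a"
      using norm_triangle_ineq[of "t *\<^sub>R b" "\<xi> *\<^sub>R a"] n1 t by simp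
    also have "\<dots> \<le> t * m" using m t by (simp flip: distrib_left add: mult_left_mono)
    finally have n2: "norm (t *\<^sub>R b + \<xi> *\<^sub>R a) \<le> t * m" .
    have n3: "norm (\<xi> *\<^sub>R a) \<le> t * m" using n1 mult_left_mono[OF m(2), of t] t by linarith
    \<comment> \<open>By linearity the two values of \<open>H\<close> differ by
      \<open>t *\<^sub>R H b\<close>, so the unknown point \<open>\<xi>\<close> survives only in the
      remainders.\<close>
    have "\<phi> t - \<phi> 0 - t\<^sup>2 * (a \<bullet> H b) = t * (a \<bullet> (e (t *\<^sub>R b + \<xi> *\<^sub>R a) - e (\<xi> *\<^sub>R a)))"
      unfolding eq e_def by (simp add: linear_add[OF lin] linear_cmul[OF lin] inner_simps
          algebra_simps power2_eq_square)
    also have "\<bar>\<dots>\<bar> \<le> t * (m * (\<epsilon> / m * t))"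
    proof -
      have "norm (e (t *\<^sub>R b + \<xi> *\<^sub>R a) - e (\<xi> *\<^sub>R a)) \<le> \<epsilon> / m * t"
        using norm_triangle_ineq4[of "e (t *\<^sub>R b + \<xi> *\<^sub>R a)" "e (\<xi> *\<^sub>R a)"] e[OF n2] e[OF n3]
        by (simp add: field_simps)
      then have "norm a * norm (e (t *\<^sub>R b + \<xi> *\<^sub>R a) - e (\<xi> *\<^sub>R a)) \<le> m * (\<epsilon> / m * t)"
        using m by (intro mult_mono) auto
      with Cauchy_Schwarz_ineq2[of a "e (t *\<^sub>R b + \<xi> *\<^sub>R a) - e (\<xi> *\<^sub>R a)"]
      have "\<bar>a \<bullet> (e (t *\<^sub>R b + \<xi> *\<^sub>R a) - e (\<xi> *\<^sub>R a))\<bar> \<le> m * (\<epsilon> / m * t)"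
        by linarith
      then show ?thesis using t by (simp only: abs_mult) (auto intro!: mult_left_mono)
    qed
    also have "\<dots> = \<epsilon> * t\<^sup>2" using m by (simp add: power2_eq_square)
    finally show "\<bar>f (z + t *\<^sub>R a + t *\<^sub>R b) - f (z + t *\<^sub>R a) - f (z + t *\<^sub>R b) + f z - t\<^sup>2 * (a \<bullet> H b)\<bar>
      \<le> \<epsilon> * t\<^sup>2" unfolding \<phi>_def by (simp add: algebra_simps)
  qed (use d m in auto)
qed

text \<open>The second difference is unchanged when \<open>a\<close> and \<open>b\<close> are
  swapped, and divided by t^2 it tends to both sides of the equation.\<close>

lemma second_derivative_symmetric:
  fixes f :: "'a::real_inner \<Rightarrow> real"
  assumes f: "\<And>z. GDERIV f z :> g z" and g: "(g has_derivative H) (at z)"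
  shows "a \<bullet> H b = b \<bullet> H a"
proof -
  have "\<bar>a \<bullet> H b - b \<bullet> H a\<bar> \<le> \<epsilon>" if "\<epsilon> > 0" for \<epsilon>
  proof -
    have "\<epsilon> / 2 > 0" using that by simp
    from second_difference_bound[OF f g this, of a b] second_difference_bound[OF f g this, of b a]
    obtain t1 t2 where t12: "t1 > 0" "t2 > 0" and
      *: "\<And>t. 0 < t \<Longrightarrow> t < t1 \<Longrightarrow> \<bar>f (z + t *\<^sub>R a + t *\<^sub>R b) - f (z + t *\<^sub>R a) - f (z + t *\<^sub>R b) + f z - t\<^sup>2 * (a \<bullet> H b)\<bar> \<le> \<epsilon> / 2 * t\<^sup>2"
        "\<And>t. 0 < t \<Longrightarrow> t < t2 \<Longrightarrow> \<bar>f (z + t *\<^sub>R b + t *\<^sub>R a) - f (z + t *\<^sub>R b) - f (z + t *\<^sub>R a) + f z - t\<^sup>2 * (b \<bullet> H a)\<bar> \<le> \<epsilon> / 2 * t\<^sup>2"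
      by blast
    define t where "t = min t1 t2 / 2"
    have t: "0 < t" "t < t1" "t < t2" using t12 unfolding t_def by auto
    have comm: "z + t *\<^sub>R b + t *\<^sub>R a = z + t *\<^sub>R a + t *\<^sub>R b" by simp
    have "\<bar>t\<^sup>2 * (a \<bullet> H b) - t\<^sup>2 * (b \<bullet> H a)\<bar> \<le> \<epsilon> * t\<^sup>2"
      using *(1)[OF t(1,2)] *(2)[OF t(1,3), unfolded comm] by linarith
    also have "t\<^sup>2 * (a \<bullet> H b) - t\<^sup>2 * (b \<bullet> H a) = t\<^sup>2 * (a \<bullet> H b - b \<bullet> H a)"
      by (simp add: algebra_simps)
    finally show ?thesis using t(1) by (simp add: abs_mult mult.commute)
  qed
  then show ?thesis
    by (metis abs_le_zero_iff dense_ge eq_iff_diff_eq_0)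
qed

text \<open>Minimality is asked only along one line, since a saddle point gives no more. The sign of
  the second derivative is shown by contradiction: a negative value would make the slope, zero at
  \<open>t = 0\<close>, negative just to the right, and \<open>f\<close> would drop below
  \<open>f z\<close>.\<close>

lemma local_min_line:
  fixes f :: "'a::real_inner \<Rightarrow> real"
  assumes f: "\<And>z. GDERIV f z :> g z" and g: "(g has_derivative H) (at z)"
    and "open U" "z \<in> U" and min: "\<And>t. z + t *\<^sub>R a \<in> U \<Longrightarrow> f z \<le> f (z + t *\<^sub>R a)"
  shows "a \<bullet> g z = 0" and "a \<bullet> H a \<ge> 0"
proof -
  obtain e where e: "e > 0" "\<And>y. norm (y - z) < e \<Longrightarrow> y \<in> U"
    using \<open>open U\<close> \<open>z \<in> U\<close> by (metis open_dist dist_norm)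
  define \<delta> where "\<delta> = e / (norm a + 1)"
  have \<delta>: "\<delta> > 0" using e unfolding \<delta>_def by (simp add: add_nonneg_pos)
  have le: "f z \<le> f (z + t *\<^sub>R a)" if "\<bar>t\<bar> < \<delta>" for t
  proof (rule min, rule e(2))
    have "\<bar>t\<bar> * norm a \<le> \<bar>t\<bar> * (norm a + 1)" by (simp add: mult_left_mono)
    also have "\<dots> < e" using that by (simp add: \<delta>_def pos_less_divide_eq add_nonneg_pos)
    finally show "norm (z + t *\<^sub>R a - z) < e" by simp
  qed
  have D: "((\<lambda>t. f (z + t *\<^sub>R a)) has_real_derivative a \<bullet> g (z + t *\<^sub>R a)) (at t)" for t
    by (rule GDERIV_line[OF f])
  show zero: "a \<bullet> g z = 0"
    using DERIV_local_min[OF D[of 0] \<delta>] le by simp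
  show "a \<bullet> H a \<ge> 0"
  proof (rule ccontr)
    assume neg: "\<not> a \<bullet> H a \<ge> 0"
    have lin: "linear H" using g has_derivative_linear by blast
    have "((\<lambda>t. z + t *\<^sub>R a) has_derivative (\<lambda>h. h *\<^sub>R a)) (at 0)"
      by (auto intro!: derivative_eq_intros)
    from has_derivative_compose[OF this, of g H] g
    have "((\<lambda>t. g (z + t *\<^sub>R a)) has_derivative (\<lambda>h. H (h *\<^sub>R a))) (at 0)" by simp
    then have "((\<lambda>t. a \<bullet> g (z + t *\<^sub>R a)) has_derivative (\<lambda>h. a \<bullet> H (h *\<^sub>R a))) (at 0)"
      by (rule has_derivative_inner_right)
    then have "((\<lambda>t. a \<bullet> g (z + t *\<^sub>R a)) has_real_derivative a \<bullet> H a) (at 0)"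
      by (simp add: has_field_derivative_def linear_cmul[OF lin] mult_commute_abs)
    from DERIV_neg_dec_right[OF this] neg zero obtain d where d: "d > 0"
      "\<And>h. 0 < h \<Longrightarrow> h < d \<Longrightarrow> a \<bullet> g (z + h *\<^sub>R a) < 0" by auto
    define b where "b = min d \<delta> / 2"
    have b: "0 < b" "b < d" "b < \<delta>" using d \<delta> unfolding b_def by auto
    have "f (z + 0 *\<^sub>R a) > f (z + b *\<^sub>R a)"
    proof (rule DERIV_neg_imp_decreasing_open[OF b(1)])
      show "\<exists>y. ((\<lambda>t. f (z + t *\<^sub>R a)) has_real_derivative y) (at x) \<and> y < 0" if "0 < x" "x < b" for x
        using D d(2)[of x] that b by auto
      show "continuous_on {0..b} (\<lambda>t. f (z + t *\<^sub>R a))"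
        using D by (meson DERIV_isCont continuous_at_imp_continuous_on)
    qed
    with le[of b] b show False by simp
  qed
qed

subsection \<open>Resolvents of Lipschitz maps\<close>

text \<open>Solving \<open>R z = v\<close> means finding a fixed point of
  \<open>\<lambda>z. v - s *\<^sub>R G z\<close>, a contraction with factor \<open>s * K\<close>.
  The bound on the inverse holds because \<open>R\<close> shrinks distances by at most the factor
  \<open>1 - s * K\<close>.\<close>

lemma resolvent_bij_lipschitz:
  fixes G :: "'a::{real_normed_vector,complete_space} \<Rightarrow> 'a"
  assumes G: "K-lipschitz_on UNIV G" and s: "0 \<le> s" "s * K < 1"
  defines "R \<equiv> \<lambda>z. z + s *\<^sub>R G z"
  shows "bij R" and "norm (inv R u - inv R v) \<le> norm (u - v) / (1 - s * K)"
proof -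
  have K: "K \<ge> 0" and lip: "norm (G u - G v) \<le> K * norm (u - v)" for u v
    using G by (auto simp: lipschitz_on_def dist_norm)
  have "\<exists>!z. v = R z" for v
  proof -
    have "dist (v - s *\<^sub>R G x) (v - s *\<^sub>R G y) \<le> s * K * dist x y" for x y
    proof -
      have "dist (v - s *\<^sub>R G x) (v - s *\<^sub>R G y) = s * norm (G x - G y)"
        using s by (simp add: dist_norm norm_minus_commute flip: scaleR_diff_right)
      also have "\<dots> \<le> s * (K * norm (x - y))" using s lip by (intro mult_left_mono)
      finally show ?thesis by (simp add: dist_norm mult.assoc)
    qed
    then have "\<exists>!z. v - s *\<^sub>R G z = z" using K s by (intro banach_fix_type) auto
    moreover have "v - s *\<^sub>R G z = z \<longleftrightarrow> v = R z" for z by (auto simp: R_def algebra_simps)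
    ultimately show ?thesis by simp
  qed
  then show bij: "bij R" by (simp add: bij_iff) metis
  have expand: "(1 - s * K) * norm (x - y) \<le> norm (R x - R y)" for x y
  proof -
    have "norm (x - y) \<le> norm (R x - R y) + norm (s *\<^sub>R (G x - G y))"
      using norm_triangle_ineq4[of "R x - R y" "s *\<^sub>R (G x - G y)"] by (simp add: R_def algebra_simps)
    moreover have "norm (s *\<^sub>R (G x - G y)) \<le> s * K * norm (x - y)"
      using mult_left_mono[OF lip[of x y] s(1)] s by (simp add: mult.assoc)
    ultimately show ?thesis by (simp add: algebra_simps)
  qed
  show "norm (inv R u - inv R v) \<le> norm (u - v) / (1 - s * K)"
    using expand[of "inv R u" "inv R v"] bij s
    by (simp add: bij_is_surj surj_f_inv_f field_simps)
qed

text \<open>An injective linear \<open>D\<close> makes \<open>norm (D x)\<close> equivalent to the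
  norm of \<open>x\<close>, so geometric decay in one gives decay in the other at the cost of a
  constant factor.\<close>

lemma exp_stable_of_local_contraction:
  fixes D :: "'a::euclidean_space \<Rightarrow> 'b::euclidean_space"
  assumes D: "linear D" "inj D" and q: "0 < q" "q < 1" and e: "e > 0" and fixed: "w z = z"
    and contr: "\<And>v. norm (v - z) < e \<Longrightarrow> norm (D (w v - z)) \<le> q * norm (D (v - z))"
  shows "exp_stable_equilibrium w z"
proof -
  obtain \<beta> where \<beta>: "\<beta> > 0" "\<And>x. \<beta> * norm x \<le> norm (D x)"
    using linear_inj_bounded_below_pos[OF D] by blast
  obtain B where B: "B > 0" "\<And>x. norm (D x) \<le> B * norm x"
    using linear_bounded_pos[OF D(1)] by blast
  \<comment> \<open>\<open>M\<close> is the cost of passing to the norm of \<open>D\<close> and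
    back. The hypothesis \<open>contr\<close> holds on a ball in the original norm, so starting
    within \<open>e / M\<close> keeps the whole orbit where it applies.\<close>
  define M where "M = B / \<beta>"
  define \<delta> where "\<delta> = e / M"
  have M: "M > 0" and \<delta>: "\<delta> > 0" using B \<beta> e by (auto simp: M_def \<delta>_def)
  have decay: "norm (D ((w ^^ k) v - z)) \<le> q ^ k * norm (D (v - z))
      \<and> norm ((w ^^ k) v - z) \<le> M * norm (v - z) * q ^ k"
    if v: "norm (v - z) < \<delta>" for v k
  proof -
    have conv: "norm ((w ^^ k) v - z) \<le> M * norm (v - z) * q ^ k"
      if "norm (D ((w ^^ k) v - z)) \<le> q ^ k * norm (D (v - z))" for k
    proof -
      have "\<beta> * norm ((w ^^ k) v - z) \<le> q ^ k * norm (D (v - z))" using \<beta>(2) that order_trans by blast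
      also have "\<dots> \<le> q ^ k * (B * norm (v - z))" using B q by (intro mult_left_mono) auto
      finally show ?thesis using \<beta>(1) by (simp add: M_def field_simps)
    qed
    have "norm (D ((w ^^ k) v - z)) \<le> q ^ k * norm (D (v - z))"
    proof (induction k)
      case (Suc k)
      have "norm ((w ^^ k) v - z) \<le> M * norm (v - z) * q ^ k" by (rule conv[OF Suc])
      also have "\<dots> \<le> M * norm (v - z) * 1"
        using M q by (intro mult_left_mono power_le_one) auto
      also have "\<dots> < e" using v M by (simp add: \<delta>_def field_simps)
      finally have "norm (D (w ((w ^^ k) v) - z)) \<le> q * norm (D ((w ^^ k) v - z))" by (rule contr)
      also have "\<dots> \<le> q * (q ^ k * norm (D (v - z)))" using Suc q by (intro mult_left_mono) auto
      finally show ?case by (simp add: mult.assoc)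
    qed simp
    with conv show ?thesis by blast
  qed
  have "stable_equilibrium w z"
    unfolding stable_equilibrium_def
  proof (intro conjI fixed allI impI)
    fix \<epsilon> :: real assume "\<epsilon> > 0"
    show "\<exists>\<delta>>0. \<forall>z0. dist z0 z < \<delta> \<longrightarrow> (\<forall>k. dist ((w ^^ k) z0) z < \<epsilon>)"
    proof (intro exI[of _ "min \<delta> (\<epsilon> / M)"] conjI allI impI)
      fix z0 k assume z0: "dist z0 z < min \<delta> (\<epsilon> / M)"
      have "norm ((w ^^ k) z0 - z) \<le> M * norm (z0 - z) * q ^ k"
        using decay z0 by (simp add: dist_norm)
      also have "\<dots> \<le> M * norm (z0 - z) * 1" using M q by (intro mult_left_mono power_le_one) auto
      also have "\<dots> < \<epsilon>" using z0 M by (simp add: dist_norm field_simps)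
      finally show "dist ((w ^^ k) z0) z < \<epsilon>" by (simp add: dist_norm)
    qed (use \<open>\<epsilon> > 0\<close> M \<delta> in auto)
  qed
  with decay M \<delta> q show ?thesis
    unfolding exp_stable_equilibrium_def dist_norm by blast
qed

text \<open>The linearization \<open>I + s M\<close> expands the norm of \<open>D\<close> by a
  factor \<open>\<rho> > 1\<close>. Near \<open>z\<close> the nonlinear remainder costs only part of
  the surplus, so the inverse contracts by \<open>1 / \<mu>\<close> with
  \<open>1 < \<mu> < \<rho>\<close>.\<close>

lemma resolvent_exp_stable:
  fixes G :: "'a::euclidean_space \<Rightarrow> 'a" and D :: "'a \<Rightarrow> 'a"
  assumes G: "K-lipschitz_on UNIV G" and s: "0 < s" "s * K < 1"
    and zero: "G z = 0" and deriv: "(G has_derivative M) (at z)" and M: "inj M"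
    and D: "linear D" "inj D" and mono: "\<And>u. D u \<bullet> D (M u) \<ge> 0"
  shows "exp_stable_equilibrium (inv (\<lambda>z. z + s *\<^sub>R G z)) z"
proof -
  define R where "R = (\<lambda>z. z + s *\<^sub>R G z)"
  have linM: "linear M" using deriv has_derivative_linear by blast
  have linDM: "linear (D \<circ> M)" and "inj (D \<circ> M)"
    using D M linM by (auto intro: linear_compose inj_compose)
  then obtain c0 where c0: "c0 > 0" "\<And>x. c0 * norm x \<le> norm (D (M x))"
    using linear_inj_bounded_below_pos[of "D \<circ> M"] by auto
  obtain \<beta> where \<beta>: "\<beta> > 0" "\<And>x. \<beta> * norm x \<le> norm (D x)"
    using linear_inj_bounded_below_pos[OF D] by blast
  obtain B where B: "B > 0" "\<And>x. norm (D x) \<le> B * norm x"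
    using linear_bounded_pos[OF D(1)] by blast
  \<comment> \<open>From \<open>norm (D (M x)) \<ge> c0 * norm x\<close> and
    \<open>norm x \<ge> norm (D x) / B\<close>. Injectivity of \<open>M\<close> enters here and
    makes the expansion strict even if the inner product in \<open>mono\<close> vanishes.\<close>
  define c where "c = c0 / B"
  have c: "c > 0" "c * norm (D x) \<le> norm (D (M x))" for x
    using c0(1) B(1) order_trans[OF mult_left_mono[OF B(2)[of x], of c]] c0(2)[of x]
    by (auto simp: c_def)
  define \<rho> where "\<rho> = sqrt (1 + (s * c)\<^sup>2)"
  have \<rho>: "\<rho> > 1" using s c(1) by (simp add: \<rho>_def)
  have expand: "\<rho> * norm (D u) \<le> norm (D (u + s *\<^sub>R M u))" for u
  proof (rule power2_le_imp_le)
    have "(s * c * norm (D u))\<^sup>2 \<le> (s * norm (D (M u)))\<^sup>2"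
      using s c by (intro power_mono) (auto simp: mult.assoc)
    \<comment> \<open>The cross term is nonnegative by \<open>mono\<close>; what remains is at least
      \<open>1 + (s * c)\<^sup>2\<close> times the square of \<open>norm (D u)\<close>.\<close>
    moreover have "(norm (D (u + s *\<^sub>R M u)))\<^sup>2 = (norm (D u))\<^sup>2 + 2 * s * (D u \<bullet> D (M u)) + (s * norm (D (M u)))\<^sup>2"
      unfolding linear_add[OF D(1)] linear_cmul[OF D(1)] power_mult_distrib power2_norm_eq_inner
      by (simp add: inner_simps inner_commute algebra_simps power2_eq_square)
    moreover have "2 * s * (D u \<bullet> D (M u)) \<ge> 0" using s mono by simp
    ultimately show "(\<rho> * norm (D u))\<^sup>2 \<le> (norm (D (u + s *\<^sub>R M u)))\<^sup>2"
      by (simp add: \<rho>_def power_mult_distrib algebra_simps)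
  qed simp
  define \<mu> where "\<mu> = (1 + \<rho>) / 2"
  have \<mu>: "1 < \<mu>" "\<mu> < \<rho>" using \<rho> by (auto simp: \<mu>_def)
  \<comment> \<open>Chosen so that the remainder, at most
    \<open>B * s * \<eta> * norm (u - z)\<close> after applying \<open>s\<close> and
    \<open>D\<close>, is exactly covered by
    \<open>(\<rho> - \<mu>) * \<beta> * norm (u - z)\<close>.\<close>
  define \<eta> where "\<eta> = (\<rho> - \<mu>) * \<beta> / (s * B)"
  have "\<eta> > 0" using \<mu> \<beta> s B by (simp add: \<eta>_def)
  then obtain d where d: "d > 0" "\<And>y. norm (y - z) < d \<Longrightarrow> norm (G y - G z - M (y - z)) \<le> \<eta> * norm (y - z)"
    using deriv unfolding has_derivative_at_alt by blast
  have local: "\<mu> * norm (D (u - z)) \<le> norm (D (R u - z))" if "norm (u - z) < d" for u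
  proof -
    define e where "e = G u - M (u - z)"
    have "norm (D (s *\<^sub>R e)) \<le> B * norm (s *\<^sub>R e)" by (rule B)
    also have "\<dots> \<le> B * (s * (\<eta> * norm (u - z)))"
      using d(2)[OF that] zero s B by (auto simp: e_def intro!: mult_left_mono)
    also have "\<dots> = (\<rho> - \<mu>) * (\<beta> * norm (u - z))" using s B by (simp add: \<eta>_def)
    also have "\<dots> \<le> (\<rho> - \<mu>) * norm (D (u - z))" using \<mu> \<beta> by (intro mult_left_mono) auto
    finally have 1: "norm (D (s *\<^sub>R e)) \<le> (\<rho> - \<mu>) * norm (D (u - z))" .
    have "R u - z = ((u - z) + s *\<^sub>R M (u - z)) + s *\<^sub>R e"
      by (simp add: R_def e_def algebra_simps)
    then have "D (R u - z) = D ((u - z) + s *\<^sub>R M (u - z)) + D (s *\<^sub>R e)"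
      using linear_add[OF D(1)] by metis
    then have "norm (D (R u - z)) \<ge> norm (D ((u - z) + s *\<^sub>R M (u - z))) - norm (D (s *\<^sub>R e))"
      using norm_diff_ineq by metis
    with expand[of "u - z"] 1 show ?thesis by (simp add: algebra_simps)
  qed
  have bij: "bij R" and lip: "norm (inv R u - inv R v) \<le> norm (u - v) / (1 - s * K)" for u v
    unfolding R_def using resolvent_bij_lipschitz[OF G _ s(2)] s(1) by auto
  have "R z = z" by (simp add: R_def zero)
  then have fixed: "inv R z = z" using bij by (metis bij_inv_eq_iff)
  have "exp_stable_equilibrium (inv R) z"
  \<comment> \<open>The inverse is Lipschitz with constant \<open>1 / (1 - s * K)\<close> and fixes
    \<open>z\<close>, so this radius puts \<open>inv R v\<close> in the ball of radius
    \<open>d\<close> where \<open>local\<close> holds.\<close>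
  proof (rule exp_stable_of_local_contraction[OF D, of "1 / \<mu>" "d * (1 - s * K)"])
    fix v assume "norm (v - z) < d * (1 - s * K)"
    then have "norm (inv R v - z) < d"
      using lip[of v z] s fixed by (simp add: pos_divide_less_eq order_le_less_trans)
    from local[OF this] show "norm (D (inv R v - z)) \<le> 1 / \<mu> * norm (D (v - z))"
      using bij \<mu> by (simp add: bij_is_surj surj_f_inv_f field_simps)
  qed (use \<mu> d s fixed in auto)
  then show ?thesis by (simp add: R_def)
qed

subsection \<open>The saddle field\<close>

text \<open>The block matrix diag(I, -I), isolated so that the saddle field is a linear isometry
  applied to the gradient and its derivative follows from the Hessian.\<close>

definition flip_y :: "real ^ ('n::finite + 'm::finite) \<Rightarrow> real ^ ('n + 'm)" where
  "flip_y z = (\<chi> k. case k of Inl i \<Rightarrow> z $ k | Inr j \<Rightarrow> - z $ k)"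

lemma saddle_field_flip: "saddle_field f z = flip_y (grad f z)"
  by (simp add: saddle_field_def flip_y_def)

lemma norm_flip_y: "norm (flip_y z) = norm z"
proof -
  have "flip_y z \<bullet> flip_y z = z \<bullet> z"
    unfolding inner_vec_def by (intro sum.cong refl) (auto simp: flip_y_def split: sum.split)
  then show ?thesis by (simp add: norm_eq)
qed

lemma linear_flip_y: "linear flip_y"
  by (intro linearI) (auto simp: flip_y_def vec_eq_iff split: sum.split)

lemma flip_y_inner: "u \<bullet> flip_y v = flip_y u \<bullet> v"
  unfolding inner_vec_def by (intro sum.cong refl) (auto simp: flip_y_def split: sum.split)

lemma timescale_nth:
  "(timescale \<tau> *v z) $ k = (case k of Inl i \<Rightarrow> 1 / \<tau> | Inr j \<Rightarrow> 1) * z $ k"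
proof -
  have "(timescale \<tau> *v z) $ k
      = (\<Sum>l\<in>UNIV. if k = l then (case k of Inl i \<Rightarrow> 1 / \<tau> | Inr j \<Rightarrow> 1) * z $ l else 0)"
    unfolding matrix_vector_mult_def timescale_def vec_lambda_beta
    by (intro sum.cong refl) (auto split: sum.split)
  then show ?thesis by simp
qed

text \<open>The sum \<open>1 + 1 / \<tau>\<close> dominates both diagonal entries, which avoids
  comparing \<open>\<tau>\<close> with 1.\<close>

lemma norm_timescale_le:
  assumes "\<tau> > 0"
  shows "norm (timescale \<tau> *v z) \<le> (1 + 1 / \<tau>) * norm z"
proof -
  have "norm (timescale \<tau> *v z) \<le> norm ((1 + 1 / \<tau>) *\<^sub>R z)"
  proof (rule norm_le_componentwise_cart)
    fix k :: "'a + 'b"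
    have "\<bar>case k of Inl i \<Rightarrow> 1 / \<tau> | Inr j \<Rightarrow> 1\<bar> \<le> \<bar>1 + 1 / \<tau>\<bar>"
      using assms by (simp split: sum.split)
    then show "norm ((timescale \<tau> *v z) $ k) \<le> norm (((1 + 1 / \<tau>) *\<^sub>R z) $ k)"
      unfolding timescale_nth vector_scaleR_component real_norm_def real_scaleR_def abs_mult
      by (rule mult_right_mono) simp
  qed
  then show ?thesis using assms by simp
qed

lemma inj_timescale: "\<tau> > 0 \<Longrightarrow> inj (\<lambda>z. timescale \<tau> *v z)"
  by (auto simp: inj_def vec_eq_iff timescale_nth split: sum.splits) (metis sum.exhaust)

text \<open>Along the x-directions \<open>z\<close> minimizes \<open>f\<close>, along the
  y-directions it minimizes \<open>- f\<close>. This signs the diagonal blocks of the Hessian; the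
  flip makes the mixed blocks cancel.\<close>

lemma saddle_point_derivatives:
  fixes f :: "real ^ ('n::finite + 'm::finite) \<Rightarrow> real"
  assumes f: "\<And>z. GDERIV f z :> g z" and g: "(g has_derivative H) (at z)" and "saddle_point f z"
  shows "g z = 0" and "u \<bullet> flip_y (H u) \<ge> 0"
proof -
  obtain x0 y0 U where z: "z = join x0 y0" and U: "open U" "z \<in> U"
    and sad: "\<And>x y. join x y \<in> U \<Longrightarrow> f (join x0 y) \<le> f z \<and> f z \<le> f (join x y0)"
    using assms(3) unfolding saddle_point_def by metis
  have X: "join a 0 \<bullet> g z = 0 \<and> join a 0 \<bullet> H (join a 0) \<ge> 0" for a :: "real ^ 'n"
  proof -
    have j: "z + t *\<^sub>R join a 0 = join (x0 + t *\<^sub>R a) y0" for t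
      by (auto simp: z join_def vec_eq_iff split: sum.split)
    show ?thesis
      using local_min_line[OF f g U, of "join a 0"] sad unfolding j by blast
  qed
  have Y: "join 0 b \<bullet> g z = 0 \<and> join 0 b \<bullet> H (join 0 b) \<le> 0" for b :: "real ^ 'm"
  proof -
    have j: "z + t *\<^sub>R join 0 b = join x0 (y0 + t *\<^sub>R b)" for t
      by (auto simp: z join_def vec_eq_iff split: sum.split)
    have f': "GDERIV (\<lambda>z. - f z) z :> - g z" for z by (rule GDERIV_minus[OF f])
    have "((\<lambda>z. - g z) has_derivative (\<lambda>h. - H h)) (at z)" using g by (rule has_derivative_minus)
    from local_min_line[OF f' this U, of "join 0 b"] sad show ?thesis unfolding j by simp
  qed
  have decomp: "\<exists>a b. v = join a 0 + join 0 b" for v :: "real ^ ('n + 'm)"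
    by (rule exI[of _ "\<chi> i. v $ Inl i"], rule exI[of _ "\<chi> j. v $ Inr j"])
      (auto simp: join_def vec_eq_iff split: sum.split)
  have "v \<bullet> g z = 0" for v
    using decomp[of v] X Y by (auto simp: inner_add_left)
  then show "g z = 0" by (metis inner_eq_zero_iff)
  obtain a b where u: "u = join a 0 + join 0 b" using decomp by blast
  have "flip_y u = join a 0 - join 0 b"
    by (auto simp: u flip_y_def join_def vec_eq_iff split: sum.split)
  then have "u \<bullet> flip_y (H u) = (join a 0 - join 0 b) \<bullet> H (join a 0 + join 0 b)"
    by (simp add: flip_y_inner u)
  \<comment> \<open>The mixed terms occur with opposite signs and are equal by symmetry of the
    second derivative.\<close>
  also have "\<dots> = join a 0 \<bullet> H (join a 0) - join 0 b \<bullet> H (join 0 b)"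
    using second_derivative_symmetric[OF f g, of "join a 0" "join 0 b"] has_derivative_linear[OF g]
    by (simp add: linear_add inner_simps)
  finally show "u \<bullet> flip_y (H u) \<ge> 0" using X[of a] Y[of b] by simp
qed

text \<open>Bijectivity is part of the conclusion because \<open>ttpp_step\<close> is defined by
  \<open>inv\<close>, which is the true inverse only for a bijection.\<close>

theorem corollary4p10:
  fixes f :: "real ^ ('n::finite + 'm::finite) \<Rightarrow> real"
    and L \<tau> :: real and r :: nat
  assumes "C2_fun f"
    and "L > 0" and "L-lipschitz_on UNIV (grad f)"
    and "\<And>z. saddle_point f z \<Longrightarrow> invertible (hessian f z)"
    and "\<tau> > 0"
    and "\<exists>s0>0. \<forall>s\<in>{0<..<s0}. C1_map (ttpp_step f \<tau> s) \<and> C1_map (ttpp_field f \<tau> s)"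
    and "r \<ge> 2" and "one_step_consistent (ttpp_step f \<tau>) (ttpp_field f \<tau>) r"
  shows "\<exists>s_star>0. \<forall>s\<in>{0<..<s_star}.
           bij (resolvent_map f \<tau> s) \<and>
           {z. saddle_point f z} \<subseteq> {z. exp_stable_equilibrium (ttpp_step f \<tau> s) z}"
proof -
  define G where "G z = timescale \<tau> *v flip_y (grad f z)" for z
  define K where "K = (1 + 1 / \<tau>) * L"
  have "K > 0" using assms(2,5) by (simp add: K_def add_pos_pos)
  have R: "resolvent_map f \<tau> s = (\<lambda>z. z + s *\<^sub>R G z)" for s
    by (simp add: fun_eq_iff resolvent_map_def G_def saddle_field_flip)
  have G: "K-lipschitz_on UNIV G"
  proof (rule lipschitz_onI)
    fix x y
    have "G x - G y = timescale \<tau> *v flip_y (grad f x - grad f y)"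
      by (simp add: G_def linear_diff[OF linear_flip_y] matrix_vector_mult_diff_distrib)
    then have "norm (G x - G y) \<le> (1 + 1 / \<tau>) * norm (grad f x - grad f y)"
      using norm_timescale_le[OF assms(5)] by (metis norm_flip_y)
    also have "\<dots> \<le> (1 + 1 / \<tau>) * (L * norm (x - y))"
      using lipschitz_onD[OF assms(3), of x y] assms(5) by (intro mult_left_mono) (auto simp: dist_norm)
    finally show "dist (G x) (G y) \<le> K * dist x y" by (simp add: K_def dist_norm mult.assoc)
  qed (use \<open>K > 0\<close> in simp)
  have f: "GDERIV f z :> grad f z" for z
    using assms(1) by (simp add: C2_fun_def GDERIV_grad)
  have g: "(grad f has_derivative (\<lambda>h. hessian f z *v h)) (at z)" for z
    using assms(1) by (simp add: C2_fun_def C1_map_def hessian_def flip: jacobian_works)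
  \<comment> \<open>With weight \<open>sqrt \<tau>\<close> on the x-block, applying \<open>D\<close>
    on both sides of the inner product cancels the timescale matrix. This reduces
    \<open>mono\<close> to the sign of \<open>u \<bullet> flip_y (H u)\<close>.\<close>
  define D :: "real ^ ('n + 'm) \<Rightarrow> real ^ ('n + 'm)"
    where "D u = (\<chi> k. (case k of Inl i \<Rightarrow> sqrt \<tau> | Inr j \<Rightarrow> 1) * u $ k)" for u
  have D: "linear D" "inj D"
    using assms(5) by (auto simp: D_def inj_def vec_eq_iff algebra_simps intro!: linearI split: sum.splits)
      (metis sum.exhaust)
  have D_inner: "D u \<bullet> D (timescale \<tau> *v v) = u \<bullet> v" for u v
    unfolding inner_vec_def using assms(5)
    by (intro sum.cong refl) (auto simp: D_def timescale_nth split: sum.split)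
  show ?thesis
  \<comment> \<open>\<open>1 / K\<close> is the threshold for \<open>s * K < 1\<close>; it depends
    on no saddle point. The neighbourhoods and decay rates may depend on both \<open>z\<close> and
    \<open>s\<close>.\<close>
  proof (intro exI[of _ "1 / K"] conjI ballI subsetI)
    fix s assume "s \<in> {0<..<1 / K}"
    then have s: "0 < s" "s * K < 1" using \<open>K > 0\<close> by (auto simp: field_simps)
    show "bij (resolvent_map f \<tau> s)" unfolding R
      by (rule resolvent_bij_lipschitz[OF G _ s(2)]) (use s in simp)
    fix z assume "z \<in> {z. saddle_point f z}"
    then have z: "saddle_point f z" by simp
    define M where "M h = timescale \<tau> *v flip_y (hessian f z *v h)" for h
    have "(G has_derivative M) (at z)"
      unfolding G_def M_def
      by (intro bounded_linear.has_derivative[OF matrix_vector_mul_bounded_linear]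
          bounded_linear.has_derivative[OF linear_linear[THEN iffD2, OF linear_flip_y]] g)
    \<comment> \<open>\<open>M\<close> composes three injective maps: the invertible Hessian, the
      isometry \<open>flip_y\<close> and the timescale matrix.\<close>
    moreover have "inj M"
    proof -
      have "inj flip_y" by (intro linear_injective_0[THEN iffD2] linear_flip_y) (metis norm_flip_y norm_eq_zero)
      moreover have "inj ((*v) (hessian f z))"
        using assms(4)[OF z] by (simp add: inj_matrix_vector_mult)
      ultimately show ?thesis
        using inj_timescale[OF assms(5)] unfolding M_def inj_def by blast
    qed
    moreover have "G z = 0"
      by (simp add: G_def saddle_point_derivatives(1)[OF f g z] linear_0[OF linear_flip_y])
    moreover have "D u \<bullet> D (M u) \<ge> 0" for u
      using saddle_point_derivatives(2)[OF f g z] by (simp add: M_def D_inner)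
    ultimately show "z \<in> {z. exp_stable_equilibrium (ttpp_step f \<tau> s) z}"
      using resolvent_exp_stable[OF G s _ _ _ D] by (simp add: ttpp_step_def R)
  qed (use \<open>K > 0\<close> in simp)
qed

end
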